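(* Let $\mathbf R=(R,\oplus,\cdot,0,1)$ be a ring-like structure of events (RLSE), and write $x':=x\oplus1$. Then $\mathbf R$ is a Boolean ring (with addition $\oplus$ and multiplication $\cdot$) if and only if $\mathbf R$ is weakly associative, i.e. satisfies $(x\oplus y)\oplus1=x\oplus(y\oplus1)$ for all $x,y$, and satisfies the identity $(xy'\oplus1)(x'y\oplus1)\oplus1= x\oplus y$ for all $x,y\in R$.
   Context: A ring-like structure of events (RLSE) is an algebra $(R,\oplus,\cdot,0,1)$ of type $(2,2,0,0)$ such that $(R,\cdot,1)$ is an idempotent commutative monoid with zero element $0$ (i.e. $x0=0$ for all $x$), satisfying the identities (R1) $x\oplus y= y\oplus x$; (R2) $(xy\oplus1)(x\oplus1)\oplus1= x$; (R3) $((xy\oplus1)x\oplus1)x= xy$; (R4) $xy\oplus(x\oplus1)=(xy\oplus1)x\oplus1$. *)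

theory Defs
  imports "HOL-Algebra.Ring"
begin

text \<open>An algebra of type \<open>(2,2,0,0)\<close> is a record of type \<^typ>\<open>'a ring\<close>; only its signature is
  used, no ring axioms are implied. All identities are relativised to the carrier.\<close>

locale rlse = comm_monoid R for R (structure) +
  assumes add_closed: "\<lbrakk>x \<in> carrier R; y \<in> carrier R\<rbrakk> \<Longrightarrow> x \<oplus> y \<in> carrier R"
    and zero_closed: "\<zero> \<in> carrier R"
    and mult_idem: "x \<in> carrier R \<Longrightarrow> x \<otimes> x = x"
    and mult_zero: "x \<in> carrier R \<Longrightarrow> x \<otimes> \<zero> = \<zero>"
    and R1: "\<lbrakk>x \<in> carrier R; y \<in> carrier R\<rbrakk> \<Longrightarrow> x \<oplus> y = y \<oplus> x"
    and R2: "\<lbrakk>x \<in> carrier R; y \<in> carrier R\<rbrakk> \<Longrightarrow>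
      (x \<otimes> y \<oplus> \<one>) \<otimes> (x \<oplus> \<one>) \<oplus> \<one> = x"
    and R3: "\<lbrakk>x \<in> carrier R; y \<in> carrier R\<rbrakk> \<Longrightarrow>
      ((x \<otimes> y \<oplus> \<one>) \<otimes> x \<oplus> \<one>) \<otimes> x = x \<otimes> y"
    and R4: "\<lbrakk>x \<in> carrier R; y \<in> carrier R\<rbrakk> \<Longrightarrow>
      x \<otimes> y \<oplus> (x \<oplus> \<one>) = (x \<otimes> y \<oplus> \<one>) \<otimes> x \<oplus> \<one>"

locale boolean_ring = ring R for R (structure) +
  assumes mult_idem: "x \<in> carrier R \<Longrightarrow> x \<otimes> x = x"

definition rlse_compl :: "('a, 'b) ring_scheme \<Rightarrow> 'a \<Rightarrow> 'a" where
  "rlse_compl R x = x \<oplus>\<^bsub>R\<^esub> \<one>\<^bsub>R\<^esub>"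

definition weakly_associative :: "('a, 'b) ring_scheme \<Rightarrow> bool" where
  "weakly_associative R \<longleftrightarrow> (\<forall>x\<in>carrier R. \<forall>y\<in>carrier R.
     (x \<oplus>\<^bsub>R\<^esub> y) \<oplus>\<^bsub>R\<^esub> \<one>\<^bsub>R\<^esub> = x \<oplus>\<^bsub>R\<^esub> (y \<oplus>\<^bsub>R\<^esub> \<one>\<^bsub>R\<^esub>))"

end

theory Submission
  imports Defs
begin

text \<open>
  An RLSE is an orthomodular lattice with meet \<open>x \<otimes> y\<close> and orthocomplement \<open>\<sim> x = x \<oplus> \<one>\<close>. The
  additional identity says that \<open>\<oplus>\<close> is its symmetric difference \<open>\<triangle>\<close>, and then weak associativity
  reads \<open>\<sim> (x \<triangle> y) = x \<triangle> \<sim> y\<close>. Meeting \<open>x\<close> with \<open>\<sim> (x \<triangle> y)\<close> and \<open>\<sim> (x \<triangle> \<sim> y)\<close> therefore gives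
  \<open>\<zero>\<close>; it also gives the part of \<open>x\<close> outside \<open>x \<otimes> \<sim> y\<close> and \<open>x \<otimes> y\<close>, so by orthomodularity \<open>x\<close> is
  the join of these two: any two elements commute. By the Foulis-Holland theorem the lattice is
  then distributive, hence Boolean, and \<open>\<oplus>\<close> is the addition of its Boolean ring.
\<close>

context rlse
begin

abbreviation compl :: "'a \<Rightarrow> 'a" (\<open>\<sim> _\<close> [81] 80)
  where "\<sim> x \<equiv> rlse_compl R x"

abbreviation below :: "'a \<Rightarrow> 'a \<Rightarrow> bool" (infix \<open>\<preceq>\<close> 50)
  where "x \<preceq> y \<equiv> x \<otimes> y = x"

declare add_closed [simp] zero_closed [simp] mult_idem [simp] mult_zero [simp]

lemma mult_idem_left [simp]:
  assumes "x \<in> carrier R" "y \<in> carrier R"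
  shows "x \<otimes> (x \<otimes> y) = x \<otimes> y"
  using assms by (simp flip: m_assoc)

lemma zero_mult [simp]: "x \<in> carrier R \<Longrightarrow> \<zero> \<otimes> x = \<zero>"
  by (simp add: m_comm[of \<zero>])

lemma compl_closed [simp]: "x \<in> carrier R \<Longrightarrow> \<sim> x \<in> carrier R"
  by (simp add: rlse_compl_def)

lemma compl_compl [simp]: "x \<in> carrier R \<Longrightarrow> \<sim> (\<sim> x) = x"
  using R2[of x \<one>] by (simp add: rlse_compl_def)

lemma compl_below_compl_mult:
  assumes "x \<in> carrier R" "y \<in> carrier R"
  shows "\<sim> x \<preceq> \<sim> (x \<otimes> y)"
proof -
  have "\<sim> (\<sim> (x \<otimes> y) \<otimes> \<sim> x) = x"
    using R2[OF assms] by (simp add: rlse_compl_def)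
  then have "\<sim> (x \<otimes> y) \<otimes> \<sim> x = \<sim> x"
    using assms compl_compl[of "\<sim> (x \<otimes> y) \<otimes> \<sim> x"] by simp
  then show ?thesis
    using assms by (simp add: m_comm)
qed

lemma compl_antimono:
  assumes "x \<in> carrier R" "y \<in> carrier R" "x \<preceq> y"
  shows "\<sim> y \<preceq> \<sim> x"
  using compl_below_compl_mult[of y x] assms by (simp add: m_comm)

lemma compl_zero [simp]: "\<sim> \<zero> = \<one>"
  using compl_below_compl_mult[of "\<sim> \<one>" \<zero>] by simp

lemma orthomodular:
  assumes "a \<in> carrier R" "x \<in> carrier R" "a \<preceq> x"
  shows "x \<otimes> \<sim> (x \<otimes> \<sim> a) = a"
  using R3[of x a] assms by (simp add: rlse_compl_def m_comm)

lemma mult_compl [simp]: "x \<in> carrier R \<Longrightarrow> x \<otimes> \<sim> x = \<zero>"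
  using orthomodular[of \<zero> x] by simp

lemma eq_if_below_and_mult_compl_zero:
  assumes "a \<in> carrier R" "x \<in> carrier R" "a \<preceq> x" "x \<otimes> \<sim> a = \<zero>"
  shows "a = x"
  using orthomodular[of a x] assms by simp

definition join :: "'a \<Rightarrow> 'a \<Rightarrow> 'a" (infixl \<open>\<curlyvee>\<close> 65)
  where "x \<curlyvee> y = \<sim> (\<sim> x \<otimes> \<sim> y)"

lemma join_closed [simp]: "\<lbrakk>x \<in> carrier R; y \<in> carrier R\<rbrakk> \<Longrightarrow> x \<curlyvee> y \<in> carrier R"
  by (simp add: join_def)

lemma join_comm: "\<lbrakk>x \<in> carrier R; y \<in> carrier R\<rbrakk> \<Longrightarrow> x \<curlyvee> y = y \<curlyvee> x"
  by (simp add: join_def m_comm)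

lemma zero_join [simp]: "x \<in> carrier R \<Longrightarrow> \<zero> \<curlyvee> x = x"
  by (simp add: join_def)

lemma compl_join: "\<lbrakk>x \<in> carrier R; y \<in> carrier R\<rbrakk> \<Longrightarrow> \<sim> (x \<curlyvee> y) = \<sim> x \<otimes> \<sim> y"
  by (simp add: join_def)

lemma below_join: "\<lbrakk>x \<in> carrier R; y \<in> carrier R\<rbrakk> \<Longrightarrow> x \<preceq> x \<curlyvee> y"
  using compl_below_compl_mult[of "\<sim> x" "\<sim> y"] by (simp add: join_def)

lemma join_least:
  assumes "a \<in> carrier R" "b \<in> carrier R" "x \<in> carrier R" "a \<preceq> x" "b \<preceq> x"
  shows "a \<curlyvee> b \<preceq> x"
proof -
  have "\<sim> x \<preceq> \<sim> a" "\<sim> x \<preceq> \<sim> b"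
    using assms by (simp_all add: compl_antimono)
  then have "\<sim> x \<preceq> \<sim> a \<otimes> \<sim> b"
    using assms by (simp flip: m_assoc)
  then show ?thesis
    using compl_antimono[of "\<sim> x" "\<sim> a \<otimes> \<sim> b"] assms by (simp add: join_def)
qed

lemma join_mult_below_mult_join:
  assumes "x \<in> carrier R" "y \<in> carrier R" "z \<in> carrier R"
  shows "x \<otimes> y \<curlyvee> x \<otimes> z \<preceq> x \<otimes> (y \<curlyvee> z)"
proof -
  have "x \<otimes> u \<preceq> x \<otimes> (u \<curlyvee> v)" if "u \<in> carrier R" "v \<in> carrier R" for u v
  proof -
    have "x \<otimes> u \<otimes> (x \<otimes> (u \<curlyvee> v)) = x \<otimes> (u \<otimes> (u \<curlyvee> v))"
      using assms that by (simp add: m_ac)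
    then show ?thesis
      using that by (simp add: below_join)
  qed
  from this[of y z] this[of z y] show ?thesis
    using assms by (intro join_least) (simp_all add: join_comm)
qed

definition commutes :: "'a \<Rightarrow> 'a \<Rightarrow> bool"
  where "commutes x y \<longleftrightarrow> x \<otimes> y \<curlyvee> x \<otimes> \<sim> y = x"

lemma commutesI:
  assumes "x \<in> carrier R" "y \<in> carrier R"
    and "x \<otimes> (\<sim> (x \<otimes> y) \<otimes> \<sim> (x \<otimes> \<sim> y)) = \<zero>"
  shows "commutes x y"
  unfolding commutes_def
proof (rule eq_if_below_and_mult_compl_zero)
  show "x \<otimes> y \<curlyvee> x \<otimes> \<sim> y \<preceq> x"
    using assms by (intro join_least) (simp_all add: m_ac)
  show "x \<otimes> \<sim> (x \<otimes> y \<curlyvee> x \<otimes> \<sim> y) = \<zero>"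
    using assms by (simp add: compl_join)
qed (use assms in simp_all)

lemma mult_compl_mult:
  assumes "x \<in> carrier R" "y \<in> carrier R" "commutes x y"
  shows "x \<otimes> \<sim> (x \<otimes> y) = x \<otimes> \<sim> y"
proof (rule eq_if_below_and_mult_compl_zero[symmetric])
  have "x \<otimes> \<sim> y \<otimes> (x \<otimes> \<sim> (x \<otimes> y)) = x \<otimes> (\<sim> y \<otimes> \<sim> (y \<otimes> x))"
    using assms by (simp add: m_ac)
  also have "\<dots> = x \<otimes> \<sim> y"
    using assms by (simp add: compl_below_compl_mult)
  finally show "x \<otimes> \<sim> y \<preceq> x \<otimes> \<sim> (x \<otimes> y)" .
  have "x \<otimes> \<sim> (x \<otimes> y) \<otimes> \<sim> (x \<otimes> \<sim> y) = x \<otimes> \<sim> (x \<otimes> y \<curlyvee> x \<otimes> \<sim> y)"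
    using assms by (simp add: compl_join m_assoc)
  then show "x \<otimes> \<sim> (x \<otimes> y) \<otimes> \<sim> (x \<otimes> \<sim> y) = \<zero>"
    using assms by (simp add: commutes_def)
qed (use assms in simp_all)

lemma mult_join_distrib_if_commutes:
  assumes "x \<in> carrier R" "y \<in> carrier R" "z \<in> carrier R"
    and "commutes x y" "commutes x z"
  shows "x \<otimes> (y \<curlyvee> z) = x \<otimes> y \<curlyvee> x \<otimes> z"
proof (rule eq_if_below_and_mult_compl_zero[symmetric])
  have "x \<otimes> (y \<curlyvee> z) \<otimes> \<sim> (x \<otimes> y \<curlyvee> x \<otimes> z) =
      (y \<curlyvee> z) \<otimes> ((x \<otimes> \<sim> (x \<otimes> y)) \<otimes> (x \<otimes> \<sim> (x \<otimes> z)))"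
    using assms by (simp add: compl_join m_ac)
  also have "\<dots> = (y \<curlyvee> z) \<otimes> ((x \<otimes> \<sim> y) \<otimes> (x \<otimes> \<sim> z))"
    using assms by (simp add: mult_compl_mult)
  also have "\<dots> = x \<otimes> ((y \<curlyvee> z) \<otimes> \<sim> (y \<curlyvee> z))"
    using assms by (simp add: compl_join m_ac)
  finally show "x \<otimes> (y \<curlyvee> z) \<otimes> \<sim> (x \<otimes> y \<curlyvee> x \<otimes> z) = \<zero>"
    using assms by simp
qed (use assms in \<open>simp_all add: join_mult_below_mult_join\<close>)

lemma eq_if_mult_eq_and_compl_mult_eq:
  assumes "a \<in> carrier R" "s \<in> carrier R" "t \<in> carrier R"
    and "commutes s a" "commutes t a"
    and "a \<otimes> s = a \<otimes> t" "\<sim> a \<otimes> s = \<sim> a \<otimes> t"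
  shows "s = t"
proof -
  have "s = a \<otimes> s \<curlyvee> \<sim> a \<otimes> s" "t = a \<otimes> t \<curlyvee> \<sim> a \<otimes> t"
    using assms(1-5) by (simp_all add: commutes_def m_comm)
  with assms(6,7) show ?thesis
    by simp
qed

definition symdiff :: "'a \<Rightarrow> 'a \<Rightarrow> 'a" (infixl \<open>\<triangle>\<close> 65)
  where "x \<triangle> y = x \<otimes> \<sim> y \<curlyvee> \<sim> x \<otimes> y"

lemma symdiff_closed [simp]: "\<lbrakk>x \<in> carrier R; y \<in> carrier R\<rbrakk> \<Longrightarrow> x \<triangle> y \<in> carrier R"
  by (simp add: symdiff_def)

lemma mult_compl_symdiff:
  assumes "x \<in> carrier R" "y \<in> carrier R"
  shows "x \<otimes> \<sim> (x \<triangle> y) = x \<otimes> \<sim> (x \<otimes> \<sim> y)"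
proof -
  have "x \<otimes> \<sim> (x \<triangle> y) = x \<otimes> \<sim> (\<sim> x \<otimes> y) \<otimes> \<sim> (x \<otimes> \<sim> y)"
    using assms by (simp add: symdiff_def compl_join m_ac)
  also have "x \<otimes> \<sim> (\<sim> x \<otimes> y) = x"
    using compl_below_compl_mult[of "\<sim> x" y] assms by simp
  finally show ?thesis .
qed

lemma commutes_if_compl_symdiff:
  assumes "x \<in> carrier R" "y \<in> carrier R" "\<sim> (x \<triangle> y) = x \<triangle> \<sim> y"
  shows "commutes x y"
proof (rule commutesI)
  have "x \<otimes> (\<sim> (x \<otimes> y) \<otimes> \<sim> (x \<otimes> \<sim> y)) =
      (x \<otimes> \<sim> (x \<otimes> \<sim> y)) \<otimes> (x \<otimes> \<sim> (x \<otimes> \<sim> (\<sim> y)))"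
    using assms by (simp add: m_ac)
  also have "\<dots> = (x \<otimes> \<sim> (x \<triangle> y)) \<otimes> (x \<otimes> \<sim> (x \<triangle> \<sim> y))"
    using assms(1,2) by (simp add: mult_compl_symdiff)
  also have "\<dots> = x \<otimes> ((x \<triangle> \<sim> y) \<otimes> \<sim> (x \<triangle> \<sim> y))"
    using assms by (simp add: m_ac del: mult_compl)
  finally show "x \<otimes> (\<sim> (x \<otimes> y) \<otimes> \<sim> (x \<otimes> \<sim> y)) = \<zero>"
    using assms(1,2) by simp
qed (use assms in simp_all)

end

locale symdiff_rlse = rlse +
  assumes add_eq_symdiff: "\<lbrakk>x \<in> carrier R; y \<in> carrier R\<rbrakk> \<Longrightarrow> x \<oplus> y = x \<triangle> y"
    and compl_add: "\<lbrakk>x \<in> carrier R; y \<in> carrier R\<rbrakk> \<Longrightarrow> \<sim> (x \<oplus> y) = x \<oplus> \<sim> y"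
begin

lemma all_commute: "\<lbrakk>x \<in> carrier R; y \<in> carrier R\<rbrakk> \<Longrightarrow> commutes x y"
  using compl_add[of x y] by (intro commutes_if_compl_symdiff) (simp_all add: add_eq_symdiff)

lemma mult_add_distrib:
  assumes "x \<in> carrier R" "y \<in> carrier R" "z \<in> carrier R"
  shows "x \<otimes> (y \<oplus> z) = x \<otimes> y \<oplus> x \<otimes> z"
proof -
  have "x \<otimes> (y \<oplus> z) = x \<otimes> (y \<otimes> \<sim> z) \<curlyvee> x \<otimes> (\<sim> y \<otimes> z)"
    using assms by (simp add: add_eq_symdiff symdiff_def mult_join_distrib_if_commutes all_commute)
  also have "x \<otimes> (y \<otimes> \<sim> z) = y \<otimes> (x \<otimes> \<sim> (x \<otimes> z))"
    using assms by (simp add: mult_compl_mult all_commute m_lcomm)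
  also have "\<dots> = x \<otimes> y \<otimes> \<sim> (x \<otimes> z)"
    using assms by (simp add: m_ac)
  also have "x \<otimes> (\<sim> y \<otimes> z) = x \<otimes> \<sim> (x \<otimes> y) \<otimes> z"
    using assms by (simp add: mult_compl_mult all_commute m_assoc)
  also have "\<dots> = \<sim> (x \<otimes> y) \<otimes> (x \<otimes> z)"
    using assms by (simp add: m_ac)
  finally show ?thesis
    using assms by (simp add: add_eq_symdiff symdiff_def)
qed

lemma zero_add: "x \<in> carrier R \<Longrightarrow> \<zero> \<oplus> x = x"
  by (simp add: add_eq_symdiff symdiff_def)

lemma add_self: "x \<in> carrier R \<Longrightarrow> x \<oplus> x = \<zero>"
  by (simp add: add_eq_symdiff symdiff_def m_comm[of "\<sim> x"])

lemma mult_add_self: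
  assumes "x \<in> carrier R" "y \<in> carrier R"
  shows "x \<otimes> (x \<oplus> y) = x \<otimes> \<sim> y"
proof -
  have "x \<otimes> (x \<oplus> y) = x \<otimes> (\<one> \<oplus> y)"
    using assms by (simp add: mult_add_distrib)
  then show ?thesis
    using assms by (simp add: rlse_compl_def R1)
qed

lemma compl_mult_add_self:
  assumes "x \<in> carrier R" "y \<in> carrier R"
  shows "\<sim> x \<otimes> (x \<oplus> y) = \<sim> x \<otimes> y"
  using assms by (simp add: mult_add_distrib m_comm[of "\<sim> x" x] zero_add)

text \<open>Multiplying by \<open>x\<close> and by \<open>\<sim> x\<close> replaces the summand \<open>x\<close> by \<open>\<one>\<close> and by \<open>\<zero>\<close>; in the first
  case associativity becomes weak associativity, in the second it is trivial.\<close>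

lemma add_assoc:
  assumes "x \<in> carrier R" "y \<in> carrier R" "z \<in> carrier R"
  shows "(x \<oplus> y) \<oplus> z = x \<oplus> (y \<oplus> z)"
proof (rule eq_if_mult_eq_and_compl_mult_eq)
  have "x \<otimes> ((x \<oplus> y) \<oplus> z) = x \<otimes> (\<sim> y \<oplus> z)"
    using assms by (simp add: mult_add_distrib[of x _ z] mult_add_self)
  also have "\<sim> y \<oplus> z = \<sim> (y \<oplus> z)"
    using assms compl_add[of z y] by (simp add: R1)
  also have "x \<otimes> \<sim> (y \<oplus> z) = x \<otimes> (x \<oplus> (y \<oplus> z))"
    using assms by (simp add: mult_add_self)
  finally show "x \<otimes> ((x \<oplus> y) \<oplus> z) = x \<otimes> (x \<oplus> (y \<oplus> z))" .
  have "\<sim> x \<otimes> ((x \<oplus> y) \<oplus> z) = \<sim> x \<otimes> (y \<oplus> z)"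
    using assms by (simp add: mult_add_distrib[of "\<sim> x" _ z] compl_mult_add_self)
  also have "\<dots> = \<sim> x \<otimes> (x \<oplus> (y \<oplus> z))"
    using assms by (simp add: compl_mult_add_self)
  finally show "\<sim> x \<otimes> ((x \<oplus> y) \<oplus> z) = \<sim> x \<otimes> (x \<oplus> (y \<oplus> z))" .
qed (use assms in \<open>simp_all add: all_commute\<close>)

lemma is_boolean_ring: "boolean_ring R"
proof -
  have "abelian_group R"
    by (rule abelian_groupI) (auto intro: add_assoc R1 zero_add add_self)
  then have "ring R"
    by (rule ringI) (simp_all add: monoid_axioms m_comm[of "_ \<oplus> _"] m_comm mult_add_distrib)
  then show ?thesis
    by (simp add: boolean_ring_def boolean_ring_axioms_def)
qed

end

context boolean_ring
begin

lemma add_self: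
  assumes "x \<in> carrier R"
  shows "x \<oplus> x = \<zero>"
proof -
  have "(x \<oplus> x) \<otimes> (x \<oplus> x) = x \<oplus> x"
    using assms by (simp add: mult_idem)
  then show ?thesis
    using assms by (simp add: l_distr r_distr mult_idem[OF assms])
qed

lemma add_self_left: "\<lbrakk>x \<in> carrier R; y \<in> carrier R\<rbrakk> \<Longrightarrow> x \<oplus> (x \<oplus> y) = y"
  by (simp add: add_self flip: a_assoc)

lemma add_one_mult_add_one:
  assumes "a \<in> carrier R" "b \<in> carrier R"
  shows "(a \<oplus> \<one>) \<otimes> (b \<oplus> \<one>) \<oplus> \<one> = a \<oplus> b \<oplus> a \<otimes> b"
  using assms by (simp add: l_distr r_distr a_ac add_self add_self_left)

lemma symdiff_identity:
  assumes "x \<in> carrier R" "y \<in> carrier R"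
  shows "(x \<otimes> (y \<oplus> \<one>) \<oplus> \<one>) \<otimes> ((x \<oplus> \<one>) \<otimes> y \<oplus> \<one>) \<oplus> \<one> = x \<oplus> y"
proof -
  let ?a = "x \<otimes> (y \<oplus> \<one>)" and ?b = "(x \<oplus> \<one>) \<otimes> y"
  have expand: "?a = x \<otimes> y \<oplus> x" "?b = x \<otimes> y \<oplus> y"
    using assms by (simp_all add: l_distr r_distr)
  have "x \<otimes> y \<otimes> y = x \<otimes> y" "x \<otimes> (x \<otimes> y) = x \<otimes> y"
    using assms by (simp add: m_assoc mult_idem, simp add: mult_idem flip: m_assoc)
  then have "?a \<otimes> ?b = \<zero>"
    using assms by (simp add: expand l_distr r_distr mult_idem add_self)
  moreover have "?a \<oplus> ?b = x \<oplus> y"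
    using assms by (simp add: expand a_ac add_self add_self_left)
  ultimately show ?thesis
    using assms by (simp add: add_one_mult_add_one)
qed

end

theorem theorem2p4:
  fixes R :: "('a, 'b) ring_scheme" (structure)
  assumes "rlse R"
  shows "boolean_ring R \<longleftrightarrow>
    weakly_associative R \<and>
    (\<forall>x\<in>carrier R. \<forall>y\<in>carrier R.
       (x \<otimes> rlse_compl R y \<oplus> \<one>) \<otimes> (rlse_compl R x \<otimes> y \<oplus> \<one>) \<oplus> \<one> = x \<oplus> y)"
    (is "_ \<longleftrightarrow> ?weak_assoc \<and> ?symdiff")
proof
  assume "boolean_ring R"
  then interpret boolean_ring R .
  show "?weak_assoc \<and> ?symdiff"
    by (simp add: weakly_associative_def rlse_compl_def a_assoc symdiff_identity)
next
  interpret rlse R by fact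
  assume "?weak_assoc \<and> ?symdiff"
  then have "symdiff_rlse R"
    by unfold_locales
      (simp_all add: weakly_associative_def rlse_compl_def symdiff_def join_def)
  then show "boolean_ring R"
    by (rule symdiff_rlse.is_boolean_ring)
qed

end
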